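(* Let $R$ be a ring with identity such that for all $a\in \mathrm{N}(R)$ and $r\in R$ one has $ar\in \mathrm{N}(R)$ (equivalently, $ra\in\mathrm{N}(R)$ for all such $a$ and $r$). Then $R$ is Dischinger. In particular, every NI ring with identity is Dischinger.
   Context: $\mathrm{N}(R)$ denotes the set of nilpotent elements of a ring $R$. A ring $R$ is NI if $\mathrm{N}(R)$ is a (two-sided) ideal of $R$. An element $a\in R$ is right strongly regular if $a=a^2x$ for some $x\in R$, left strongly regular if $a=ya^2$ for some $y\in R$, and strongly regular if both. $R$ is right (respectively left) Dischinger if every right (respectively left) strongly regular element of $R$ is strongly regular; $R$ is Dischinger if it is both left and right Dischinger. *)

theory Defs
  imports "HOL-Algebra.Ideal"
begin

text \<open>
  Rings are rings with identity in the sense of the locale \<open>ring\<close>: not necessarily commutative,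
  the zero ring included.
\<close>

definition nilpotents :: "('a, 'b) ring_scheme \<Rightarrow> 'a set" where
  "nilpotents R = {a \<in> carrier R. \<exists>n::nat. n > 0 \<and> a [^]\<^bsub>R\<^esub> n = \<zero>\<^bsub>R\<^esub>}"

definition NI_ring :: "('a, 'b) ring_scheme \<Rightarrow> bool" where
  "NI_ring R \<longleftrightarrow> ring R \<and> ideal (nilpotents R) R"

definition right_strongly_regular :: "('a, 'b) ring_scheme \<Rightarrow> 'a \<Rightarrow> bool" where
  "right_strongly_regular R a \<longleftrightarrow>
     a \<in> carrier R \<and> (\<exists>x \<in> carrier R. a = a [^]\<^bsub>R\<^esub> (2::nat) \<otimes>\<^bsub>R\<^esub> x)"

definition left_strongly_regular :: "('a, 'b) ring_scheme \<Rightarrow> 'a \<Rightarrow> bool" where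
  "left_strongly_regular R a \<longleftrightarrow>
     a \<in> carrier R \<and> (\<exists>y \<in> carrier R. a = y \<otimes>\<^bsub>R\<^esub> a [^]\<^bsub>R\<^esub> (2::nat))"

definition strongly_regular :: "('a, 'b) ring_scheme \<Rightarrow> 'a \<Rightarrow> bool" where
  "strongly_regular R a \<longleftrightarrow> right_strongly_regular R a \<and> left_strongly_regular R a"

definition right_Dischinger :: "('a, 'b) ring_scheme \<Rightarrow> bool" where
  "right_Dischinger R \<longleftrightarrow>
     ring R \<and> (\<forall>a \<in> carrier R. right_strongly_regular R a \<longrightarrow> strongly_regular R a)"

definition left_Dischinger :: "('a, 'b) ring_scheme \<Rightarrow> bool" where
  "left_Dischinger R \<longleftrightarrow>
     ring R \<and> (\<forall>a \<in> carrier R. left_strongly_regular R a \<longrightarrow> strongly_regular R a)"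

definition Dischinger :: "('a, 'b) ring_scheme \<Rightarrow> bool" where
  "Dischinger R \<longleftrightarrow> left_Dischinger R \<and> right_Dischinger R"

end

theory Submission
  imports Defs "HOL-Algebra.Multiplicative_Group"
begin

text \<open>
  Suppose that nilpotent elements absorb right factors, and let \<open>a = a a x\<close>. Put \<open>h = 1 - x a\<close>.
  Since \<open>a a h = 0\<close>, the element \<open>a h = (1 - a x) a\<close> squares to zero, so \<open>h a\<close> is nilpotent too, and
  hence so is \<open>h a x = a x - x a\<close> (lemma \<open>commutator_nilpotent\<close>). Thus every \<open>x\<close> with \<open>a = a a x\<close>
  commutes with \<open>a\<close> up to a nilpotent \<open>k = a x - x a\<close>, and this is used twice.

  The first use makes \<open>a\<close> von Neumann regular. The defect \<open>a - a x a\<close> equals \<open>a k\<close>, and \<open>x\<close> can be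
  corrected step by step, without losing \<open>a = a a x\<close>, so that the defect becomes \<open>a k\<^sup>2\<close>, \<open>a k\<^sup>3\<close>, and
  so on (lemma \<open>ex_inverse_with_defect_power\<close>). As \<open>k\<close> is nilpotent, some \<open>z\<close> satisfies
  \<open>a = a a z = a z a\<close>.

  The second use is with this \<open>z\<close> and \<open>k = a z - z a\<close>. Now \<open>a z\<close> is idempotent and \<open>a k = 0\<close>, which
  gives \<open>k k = a z k\<close> and \<open>k k k = k k\<close>. A nilpotent \<open>k\<close> with this property has square zero, so
  \<open>a z k = 0\<close>, that is, \<open>a z = a z z a\<close>; right multiplication by \<open>a\<close> yields \<open>a = (a z z) a a\<close>
  (lemma \<open>eq_mult_square_if_nilpotent_commutator\<close>).

  The condition on nilpotents is left-right symmetric because \<open>a r\<close> is nilpotent exactly when \<open>r a\<close>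
  is. The implication from left to right strong regularity is therefore the one just proved,
  read in the opposite ring.
\<close>

lemma nilpotentsI:
  "a \<in> carrier R \<Longrightarrow> a [^]\<^bsub>R\<^esub> Suc n = \<zero>\<^bsub>R\<^esub> \<Longrightarrow> a \<in> nilpotents R"
  unfolding nilpotents_def by blast

context ring
begin

lemma nilpotentsE:
  assumes "a \<in> nilpotents R"
  obtains n :: nat where "a \<in> carrier R" "a [^] n = \<zero>"
  using assms unfolding nilpotents_def by blast

lemma pow_two: "a \<in> carrier R \<Longrightarrow> a [^] (2::nat) = a \<otimes> a"
  by (simp add: numeral_2_eq_2)

lemma mult_pow_Suc_shift:
  assumes "a \<in> carrier R" "b \<in> carrier R"
  shows "(b \<otimes> a) [^] Suc n = b \<otimes> (a \<otimes> b) [^] (n::nat) \<otimes> a"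
proof (induction n)
  case 0
  then show ?case using assms by simp
next
  case (Suc n)
  have "(b \<otimes> a) [^] Suc (Suc n) = (b \<otimes> (a \<otimes> b) [^] n \<otimes> a) \<otimes> (b \<otimes> a)"
    by (simp only: Suc.IH nat_pow_Suc[of _ "Suc n"])
  also have "\<dots> = b \<otimes> (a \<otimes> b) [^] Suc n \<otimes> a"
    using assms by (simp add: m_assoc)
  finally show ?case .
qed

lemma nilpotents_mult_swap:
  assumes "a \<in> carrier R" "b \<in> carrier R" "a \<otimes> b \<in> nilpotents R"
  shows "b \<otimes> a \<in> nilpotents R"
proof -
  obtain n :: nat where "(a \<otimes> b) [^] n = \<zero>"
    using assms(3) by (rule nilpotentsE)
  then have "(b \<otimes> a) [^] Suc n = \<zero>"
    using assms by (simp only: mult_pow_Suc_shift) simp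
  moreover have "b \<otimes> a \<in> carrier R" using assms by simp
  ultimately show ?thesis by (intro nilpotentsI)
qed

text \<open>
  The element \<open>a x - x a\<close> equals \<open>(1 - x a) a x\<close>, a right multiple of the nilpotent element
  \<open>(1 - x a) a\<close>.
\<close>

lemma commutator_nilpotent:
  assumes nil: "\<forall>a \<in> nilpotents R. \<forall>r \<in> carrier R. a \<otimes> r \<in> nilpotents R"
    and a: "a \<in> carrier R" and x: "x \<in> carrier R" and eq: "a \<otimes> a \<otimes> x = a"
  shows "a \<otimes> x \<ominus> x \<otimes> a \<in> nilpotents R"
proof -
  define h where "h = \<one> \<ominus> x \<otimes> a"
  have h: "h \<in> carrier R" using a x by (simp add: h_def)
  have ah: "a \<otimes> h = a \<ominus> a \<otimes> x \<otimes> a"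
    using a x by (simp add: h_def minus_eq r_distr r_minus m_assoc)
  have aah_expand: "a \<otimes> (a \<otimes> h) = a \<otimes> a \<ominus> a \<otimes> a \<otimes> x \<otimes> a"
    unfolding ah using a x by (simp add: minus_eq r_distr r_minus m_assoc)
  have aah: "a \<otimes> (a \<otimes> h) = \<zero>"
    unfolding aah_expand eq using a by (simp add: minus_eq r_neg)
  have "(a \<otimes> h) \<otimes> (a \<otimes> h) = (a \<ominus> a \<otimes> x \<otimes> a) \<otimes> (a \<otimes> h)"
    by (simp only: ah)
  also have "\<dots> = a \<otimes> (a \<otimes> h) \<ominus> a \<otimes> x \<otimes> (a \<otimes> (a \<otimes> h))"
    using a x h by (simp add: minus_eq l_distr l_minus m_assoc)
  also have "\<dots> = \<zero>" unfolding aah using a x by (simp add: minus_eq)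
  finally have "(a \<otimes> h) [^] Suc 1 = \<zero>" using a h by simp
  moreover have "a \<otimes> h \<in> carrier R" using a h by simp
  ultimately have "a \<otimes> h \<in> nilpotents R" by (intro nilpotentsI)
  then have "h \<otimes> a \<in> nilpotents R" using a h by (rule nilpotents_mult_swap[rotated 2])
  then have "h \<otimes> a \<otimes> x \<in> nilpotents R" using nil x by blast
  moreover have "h \<otimes> a \<otimes> x = a \<otimes> x \<ominus> x \<otimes> (a \<otimes> a \<otimes> x)"
    using a x by (simp add: h_def minus_eq l_distr l_minus m_assoc)
  ultimately show ?thesis by (simp add: eq)
qed

text \<open>
  Replacing \<open>z\<close> by \<open>x + z (1 - a x)\<close> keeps \<open>a a z = a\<close>, because \<open>a (1 - a x) = 0\<close>, and multiplies the
  defects: \<open>1 - a z\<close> becomes \<open>(1 - a z) (1 - a x)\<close>. Since \<open>(1 - a x) a = a k\<close> for the commutator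
  \<open>k = a x - x a\<close>, each such step appends one factor \<open>k\<close> to the defect \<open>a - a z a\<close>.
\<close>

lemma ex_inverse_with_defect_power:
  assumes a: "a \<in> carrier R" and x: "x \<in> carrier R" and eq: "a \<otimes> a \<otimes> x = a"
  shows "\<exists>z \<in> carrier R. a \<otimes> a \<otimes> z = a
           \<and> a \<ominus> a \<otimes> z \<otimes> a = a \<otimes> (a \<otimes> x \<ominus> x \<otimes> a) [^] Suc n"
proof -
  define k where "k = a \<otimes> x \<ominus> x \<otimes> a"
  have k: "k \<in> carrier R" using a x by (simp add: k_def)
  have ak: "a \<otimes> k = a \<ominus> a \<otimes> x \<otimes> a"
  proof -
    have "a \<otimes> k = a \<otimes> a \<otimes> x \<ominus> a \<otimes> x \<otimes> a"
      using a x by (simp add: k_def minus_eq r_distr r_minus m_assoc)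
    then show ?thesis by (simp add: eq)
  qed
  have "\<exists>z \<in> carrier R. a \<otimes> a \<otimes> z = a \<and> a \<ominus> a \<otimes> z \<otimes> a = a \<otimes> k [^] Suc n"
  proof (induction n)
    case 0
    then show ?case using x k eq ak by auto
  next
    case (Suc n)
    then obtain z where z: "z \<in> carrier R" and z1: "a \<otimes> a \<otimes> z = a"
      and z2: "a \<ominus> a \<otimes> z \<otimes> a = a \<otimes> k [^] Suc n" by blast
    define w where "w = x \<oplus> z \<otimes> (\<one> \<ominus> a \<otimes> x)"
    have w: "w \<in> carrier R" using a x z by (simp add: w_def)
    have "a \<otimes> a \<otimes> w = a \<otimes> a \<otimes> x \<oplus> (a \<otimes> a \<otimes> z) \<otimes> (\<one> \<ominus> a \<otimes> x)"
      using a x z by (simp add: w_def r_distr m_assoc)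
    also have "\<dots> = a \<oplus> a \<otimes> (\<one> \<ominus> a \<otimes> x)" by (simp only: eq z1)
    also have "\<dots> = a \<oplus> (a \<ominus> a \<otimes> a \<otimes> x)"
      using a x by (simp add: minus_eq r_distr r_minus m_assoc)
    also have "\<dots> = a" unfolding eq using a by (simp add: minus_eq r_neg)
    finally have w1: "a \<otimes> a \<otimes> w = a" .
    have "a \<ominus> a \<otimes> w \<otimes> a = (a \<ominus> a \<otimes> x \<otimes> a) \<ominus> a \<otimes> z \<otimes> (a \<ominus> a \<otimes> x \<otimes> a)"
      using a x z
      by (simp add: w_def minus_eq r_distr l_distr r_minus l_minus minus_add m_assoc a_assoc)
    also have "\<dots> = a \<otimes> k \<ominus> a \<otimes> z \<otimes> (a \<otimes> k)" by (simp only: ak)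
    also have "\<dots> = (a \<ominus> a \<otimes> z \<otimes> a) \<otimes> k"
      using a k z by (simp add: minus_eq l_distr l_minus m_assoc)
    also have "\<dots> = a \<otimes> k [^] Suc (Suc n)"
      unfolding z2 using a k by (simp add: m_assoc)
    finally show ?case using w w1 by blast
  qed
  then show ?thesis by (simp only: k_def)
qed

text \<open>
  For the idempotent \<open>e = a z\<close> and the commutator \<open>k = e - z a\<close>, the equation \<open>a k = 0\<close> gives
  \<open>k k = e k\<close>. Hence all powers of \<open>k\<close> from the second on equal \<open>e k\<close>, which vanishes when \<open>k\<close> is
  nilpotent; and \<open>e k = 0\<close> says that \<open>e\<close> is a left multiple of \<open>a\<close>.
\<close>

lemma eq_mult_square_if_nilpotent_commutator:
  assumes a: "a \<in> carrier R" and z: "z \<in> carrier R"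
    and eq: "a \<otimes> a \<otimes> z = a" and reg: "a \<otimes> z \<otimes> a = a"
    and nil: "a \<otimes> z \<ominus> z \<otimes> a \<in> nilpotents R"
  shows "a = a \<otimes> z \<otimes> z \<otimes> (a \<otimes> a)"
proof -
  define k where "k = a \<otimes> z \<ominus> z \<otimes> a"
  have k: "k \<in> carrier R" using a z by (simp add: k_def)
  have "a \<otimes> k = a \<otimes> a \<otimes> z \<ominus> a \<otimes> z \<otimes> a"
    using a z by (simp add: k_def minus_eq r_distr r_minus m_assoc)
  then have ak: "a \<otimes> k = \<zero>" unfolding eq reg using a by (simp add: minus_eq r_neg)
  have "k \<otimes> k = a \<otimes> z \<otimes> k \<ominus> z \<otimes> (a \<otimes> k)"
    using a z k by (subst (1) k_def) (simp add: minus_eq l_distr l_minus m_assoc)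
  then have kk: "k \<otimes> k = a \<otimes> z \<otimes> k" unfolding ak using a z k by (simp add: minus_eq)
  have idem: "a \<otimes> z \<otimes> (a \<otimes> z) = a \<otimes> z"
    using reg a z by (metis m_assoc m_closed)
  have pow: "k [^] Suc (Suc n) = k \<otimes> k" for n
  proof (induction n)
    case 0
    then show ?case using k by simp
  next
    case (Suc n)
    have "k [^] Suc (Suc (Suc n)) = k \<otimes> k \<otimes> k" by (simp only: Suc.IH nat_pow_Suc[of _ "Suc (Suc n)"])
    also have "\<dots> = a \<otimes> z \<otimes> (k \<otimes> k)" by (subst kk) (use a z k in \<open>simp add: m_assoc\<close>)
    also have "\<dots> = a \<otimes> z \<otimes> (a \<otimes> z) \<otimes> k" unfolding kk using a z k by (simp add: m_assoc)
    also have "\<dots> = k \<otimes> k" by (simp only: idem kk)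
    finally show ?case .
  qed
  obtain n :: nat where "k [^] n = \<zero>"
    using nil unfolding k_def by (rule nilpotentsE)
  then have "k [^] Suc (Suc n) = \<zero>" using k by simp
  then have "a \<otimes> z \<otimes> k = \<zero>" by (simp only: pow kk)
  moreover have "a \<otimes> z \<otimes> k = a \<otimes> z \<otimes> (a \<otimes> z) \<ominus> a \<otimes> z \<otimes> z \<otimes> a"
    using a z by (simp add: k_def minus_eq r_distr r_minus m_assoc)
  ultimately have "a \<otimes> z = a \<otimes> z \<otimes> z \<otimes> a"
    unfolding idem using a z by simp
  then have "a \<otimes> z \<otimes> a = a \<otimes> z \<otimes> z \<otimes> a \<otimes> a" by simp
  then show ?thesis unfolding reg using a z by (simp add: m_assoc)
qed

lemma right_strongly_regular_imp_left:
  assumes nil: "\<forall>a \<in> nilpotents R. \<forall>r \<in> carrier R. a \<otimes> r \<in> nilpotents R"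
    and "right_strongly_regular R a"
  shows "left_strongly_regular R a"
proof -
  obtain x where a: "a \<in> carrier R" and x: "x \<in> carrier R" and eq: "a \<otimes> a \<otimes> x = a"
    using assms(2) unfolding right_strongly_regular_def by (metis pow_two)
  obtain n :: nat where n: "(a \<otimes> x \<ominus> x \<otimes> a) [^] n = \<zero>"
    using commutator_nilpotent[OF nil a x eq] by (rule nilpotentsE)
  obtain z where z: "z \<in> carrier R" and z1: "a \<otimes> a \<otimes> z = a"
    and "a \<ominus> a \<otimes> z \<otimes> a = a \<otimes> (a \<otimes> x \<ominus> x \<otimes> a) [^] Suc n"
    using ex_inverse_with_defect_power[OF a x eq] by blast
  then have "a \<ominus> a \<otimes> z \<otimes> a = \<zero>" using a x n by simp
  then have "a \<otimes> z \<otimes> a = a" using a z by simp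
  then have "a = a \<otimes> z \<otimes> z \<otimes> a [^] (2::nat)"
    unfolding pow_two[OF a]
    using eq_mult_square_if_nilpotent_commutator[OF a z z1]
      commutator_nilpotent[OF nil a z z1] by blast
  moreover have "a \<otimes> z \<otimes> z \<in> carrier R" using a z by simp
  ultimately show ?thesis
    unfolding left_strongly_regular_def using a by blast
qed

end

text \<open>
  Updating only the multiplication leaves any record extension of \<open>R\<close> in place, so the opposite
  ring has the same type as \<open>R\<close>.
\<close>

definition opposite_ring :: "('a, 'b) ring_scheme \<Rightarrow> ('a, 'b) ring_scheme" where
  "opposite_ring R = R\<lparr>mult := \<lambda>x y. y \<otimes>\<^bsub>R\<^esub> x\<rparr>"

lemma opposite_ring_simps [simp]:
  "carrier (opposite_ring R) = carrier R"
  "x \<otimes>\<^bsub>opposite_ring R\<^esub> y = y \<otimes>\<^bsub>R\<^esub> x"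
  "x \<oplus>\<^bsub>opposite_ring R\<^esub> y = x \<oplus>\<^bsub>R\<^esub> y"
  "\<zero>\<^bsub>opposite_ring R\<^esub> = \<zero>\<^bsub>R\<^esub>"
  "\<one>\<^bsub>opposite_ring R\<^esub> = \<one>\<^bsub>R\<^esub>"
  by (simp_all add: opposite_ring_def)

context ring
begin

lemma ring_opposite_ring: "ring (opposite_ring R)"
proof (rule ringI)
  show "abelian_group (opposite_ring R)"
  proof (rule abelian_groupI)
    fix x assume "x \<in> carrier (opposite_ring R)"
    then show "\<exists>y \<in> carrier (opposite_ring R). y \<oplus>\<^bsub>opposite_ring R\<^esub> x = \<zero>\<^bsub>opposite_ring R\<^esub>"
      using l_neg a_inv_closed by auto
  qed (simp_all add: a_ac)
  show "monoid (opposite_ring R)"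
    by (rule monoidI) (auto simp: m_assoc)
qed (auto simp: l_distr r_distr)

lemma pow_opposite_ring:
  assumes "a \<in> carrier R"
  shows "a [^]\<^bsub>opposite_ring R\<^esub> n = a [^] (n::nat)"
proof -
  interpret op: ring "opposite_ring R" by (rule ring_opposite_ring)
  show ?thesis
  proof (induction n)
    case (Suc n)
    have "a [^]\<^bsub>opposite_ring R\<^esub> Suc n = a \<otimes> a [^] n"
      by (simp only: op.nat_pow_Suc opposite_ring_simps Suc.IH)
    then show ?case using assms by (simp only: nat_pow_Suc2)
  qed simp
qed

lemma nilpotents_opposite_ring: "nilpotents (opposite_ring R) = nilpotents R"
  by (auto simp: nilpotents_def pow_opposite_ring)

lemma strongly_regular_opposite_ring:
  "right_strongly_regular (opposite_ring R) a \<longleftrightarrow> left_strongly_regular R a"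
  "left_strongly_regular (opposite_ring R) a \<longleftrightarrow> right_strongly_regular R a"
  by (simp_all add: right_strongly_regular_def left_strongly_regular_def pow_opposite_ring
      cong: conj_cong)

lemma Dischinger_if_nilpotents_absorb_right:
  assumes nil: "\<forall>a \<in> nilpotents R. \<forall>r \<in> carrier R. a \<otimes> r \<in> nilpotents R"
  shows "Dischinger R"
proof -
  interpret op: ring "opposite_ring R" by (rule ring_opposite_ring)
  have "r \<otimes> a \<in> nilpotents R" if "a \<in> nilpotents R" "r \<in> carrier R" for a r
    using that nil nilpotents_mult_swap by (blast elim: nilpotentsE)
  then have "left_strongly_regular (opposite_ring R) a"
    if "right_strongly_regular (opposite_ring R) a" for a
    using that by (intro op.right_strongly_regular_imp_left)
      (auto simp: nilpotents_opposite_ring)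
  then have "right_strongly_regular R a" if "left_strongly_regular R a" for a
    using that by (simp add: strongly_regular_opposite_ring)
  then show ?thesis
    unfolding Dischinger_def left_Dischinger_def right_Dischinger_def strongly_regular_def
    using right_strongly_regular_imp_left[OF nil] ring_axioms by blast
qed

end

theorem corollary2p6:
  fixes R :: "('a, 'b) ring_scheme" (structure)
  assumes "ring R"
  shows "((\<forall>a \<in> nilpotents R. \<forall>r \<in> carrier R. a \<otimes> r \<in> nilpotents R) \<longleftrightarrow>
          (\<forall>a \<in> nilpotents R. \<forall>r \<in> carrier R. r \<otimes> a \<in> nilpotents R))
       \<and> ((\<forall>a \<in> nilpotents R. \<forall>r \<in> carrier R. a \<otimes> r \<in> nilpotents R) \<longrightarrow> Dischinger R)
       \<and> (NI_ring R \<longrightarrow> Dischinger R)"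
proof -
  interpret ring R by (rule assms)
  have "a \<otimes> r \<in> nilpotents R \<longleftrightarrow> r \<otimes> a \<in> nilpotents R"
    if "a \<in> nilpotents R" "r \<in> carrier R" for a r
    using that nilpotents_mult_swap by (blast elim: nilpotentsE)
  moreover have "\<forall>a \<in> nilpotents R. \<forall>r \<in> carrier R. a \<otimes> r \<in> nilpotents R" if "NI_ring R"
    using that unfolding NI_ring_def by (simp add: ideal.I_r_closed)
  ultimately show ?thesis
    using Dischinger_if_nilpotents_absorb_right by blast
qed

end
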